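(* Let $k\geq1$, $\varepsilon>0$, and let $\mathbf{p}$ be a distribution over $[k]\times[k]$ with marginals $\mathbf{p}_1,\mathbf{p}_2$. Let $S_1,S_2\subseteq[k]$ be chosen independently and uniformly at random among all subsets of $[k]$. Then: (i) if $\mathbf{p}=\mathbf{p}_1\otimes\mathbf{p}_2$, then $\mathbf{p}(S_1\times S_2)=\mathbf{p}_1(S_1)\mathbf{p}_2(S_2)$ with probability one; and (ii) if $d_{TV}(\mathbf{p},\mathbf{p}_1\otimes\mathbf{p}_2)>\varepsilon$, then $$\Pr_{S_1,S_2}\Big[\big(\mathbf{p}(S_1\times S_2)-\mathbf{p}_1(S_1)\mathbf{p}_2(S_2)\big)^2>\frac{\varepsilon^2}{8k^2}\Big]\geq c$$ for some absolute constant $c>0$; moreover one can take $c=1/4096$.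
   Context: $[k]=\{1,\dots,k\}$; $d_{TV}(\mathbf{p},\mathbf{q})=\frac12\sum_x|\mathbf{p}(x)-\mathbf{q}(x)|$; $\mathbf{p}_1\otimes\mathbf{p}_2$ denotes the product distribution $(x_1,x_2)\mapsto\mathbf{p}_1(x_1)\mathbf{p}_2(x_2)$; for a set $A$, $\mathbf{p}(A)=\sum_{a\in A}\mathbf{p}(a)$. *)

theory Defs
  imports "HOL-Probability.Probability"
begin

definition d_TV :: "'a pmf \<Rightarrow> 'a pmf \<Rightarrow> real" where
  "d_TV p q = 1 / 2 * (\<Sum>\<^sub>\<infinity>x\<in>UNIV. \<bar>pmf p x - pmf q x\<bar>)"

definition random_subset_pair :: "nat \<Rightarrow> (nat set \<times> nat set) pmf" where
  "random_subset_pair k = pair_pmf (pmf_of_set (Pow {1..k})) (pmf_of_set (Pow {1..k}))"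

end

theory Submission
  imports Defs
begin

text \<open>
  Let \<open>\<Delta>(i,j) = p(i,j) - p1(i) p2(j)\<close>, whose rows and columns sum to zero. Encoding \<open>S1\<close> and \<open>S2\<close> by
  independent uniform signs \<open>x\<close> and \<open>y\<close>, the discrepancy \<open>p(S1 \<times> S2) - p1(S1) p2(S2)\<close> becomes
  \<open>Z / 4\<close> with \<open>Z = \<Sum> \<Delta>(i,j) x(i) y(j)\<close>. Then \<open>E Z\<^sup>2 = \<Sum> \<Delta>(i,j)\<^sup>2\<close>, which exceeds \<open>4 \<epsilon>\<^sup>2 / k\<^sup>2\<close> by
  Cauchy-Schwarz, and applying Khinchin's fourth-moment inequality in each variable gives
  \<open>E Z\<^sup>4 \<le> 9 (E Z\<^sup>2)\<^sup>2\<close>. By the Paley-Zygmund inequality, \<open>Z\<^sup>2 > E Z\<^sup>2 / 2\<close> with probability at least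
  \<open>1/36\<close>.
\<close>

section \<open>Moments of linear sums of independent random signs\<close>

definition subset_sign :: "'a set \<Rightarrow> 'a \<Rightarrow> real" where
  "subset_sign S i = (if i \<in> S then 1 else -1)"

lemma sum_Pow_insert:
  fixes f :: "'a set \<Rightarrow> 'b::comm_monoid_add"
  assumes "finite A" "x \<notin> A"
  shows "(\<Sum>S\<in>Pow (insert x A). f S) = (\<Sum>S\<in>Pow A. f S + f (insert x S))"
proof -
  have "(\<Sum>S\<in>Pow (insert x A). f S) = sum f (Pow A) + sum f (insert x ` Pow A)"
    unfolding Pow_insert using assms by (intro sum.union_disjoint) auto
  also have "sum f (insert x ` Pow A) = (\<Sum>S\<in>Pow A. f (insert x S))"
    using assms by (subst sum.reindex) (auto simp: inj_on_def)
  finally show ?thesis by (simp add: sum.distrib)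
qed

lemma signed_sum_insert:
  assumes "finite A" "x \<notin> A" "S \<subseteq> A"
  shows "(\<Sum>i\<in>insert x A. a i * subset_sign S i) = (\<Sum>i\<in>A. a i * subset_sign S i) - a x"
    and "(\<Sum>i\<in>insert x A. a i * subset_sign (insert x S) i)
           = (\<Sum>i\<in>A. a i * subset_sign S i) + a x"
proof -
  have "(\<Sum>i\<in>A. a i * subset_sign (insert x S) i) = (\<Sum>i\<in>A. a i * subset_sign S i)"
    using assms by (intro sum.cong) (auto simp: subset_sign_def)
  then show "(\<Sum>i\<in>insert x A. a i * subset_sign (insert x S) i)
           = (\<Sum>i\<in>A. a i * subset_sign S i) + a x"
    using assms by (simp add: subset_sign_def)
  have "x \<notin> S" using assms by blast
  then show "(\<Sum>i\<in>insert x A. a i * subset_sign S i) = (\<Sum>i\<in>A. a i * subset_sign S i) - a x"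
    using assms by (simp add: subset_sign_def)
qed

text \<open>The two signs of a new element pair up as (X - a)^2 + (X + a)^2, so cross terms cancel
  and each induction step doubles the number of subsets.\<close>

lemma signed_sum_second_moment:
  assumes "finite A"
  shows "(\<Sum>S\<in>Pow A. (\<Sum>i\<in>A. a i * subset_sign S i)\<^sup>2) = 2 ^ card A * (\<Sum>i\<in>A. (a i)\<^sup>2)"
  using assms
proof (induction A)
  case (insert x A)
  let ?X = "\<lambda>S. \<Sum>i\<in>A. a i * subset_sign S i"
  have "(\<Sum>S\<in>Pow (insert x A). (\<Sum>i\<in>insert x A. a i * subset_sign S i)\<^sup>2)
      = (\<Sum>S\<in>Pow A. (?X S - a x)\<^sup>2 + (?X S + a x)\<^sup>2)"
    unfolding sum_Pow_insert[OF insert.hyps]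
    by (intro sum.cong refl) (simp add: signed_sum_insert[OF insert.hyps] del: sum.insert)
  also have "\<dots> = (\<Sum>S\<in>Pow A. 2 * (?X S)\<^sup>2 + 2 * (a x)\<^sup>2)"
    by (intro sum.cong refl) (simp add: power2_eq_square algebra_simps)
  also have "\<dots> = 2 * (2 ^ card A * (\<Sum>i\<in>A. (a i)\<^sup>2)) + 2 ^ card A * (2 * (a x)\<^sup>2)"
    by (simp add: sum.distrib flip: sum_distrib_left insert.IH) (simp add: card_Pow insert.hyps)
  also have "\<dots> = 2 ^ card (insert x A) * (\<Sum>i\<in>insert x A. (a i)\<^sup>2)"
    using insert.hyps by (simp add: algebra_simps)
  finally show ?case .
qed simp

text \<open>Khinchin's inequality is the case \<open>a = b\<close>; the mixed form is what gets summed over the rows of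
  a matrix in the bilinear version.\<close>

lemma signed_sum_mixed_fourth_moment:
  assumes "finite A"
  shows "(\<Sum>S\<in>Pow A. (\<Sum>i\<in>A. a i * subset_sign S i)\<^sup>2 * (\<Sum>i\<in>A. b i * subset_sign S i)\<^sup>2)
    \<le> 3 * 2 ^ card A * ((\<Sum>i\<in>A. (a i)\<^sup>2) * (\<Sum>i\<in>A. (b i)\<^sup>2))"
  using assms
proof (induction A)
  case (insert x A)
  let ?X = "\<lambda>S. \<Sum>i\<in>A. a i * subset_sign S i" and ?Y = "\<lambda>S. \<Sum>i\<in>A. b i * subset_sign S i"
  let ?a = "\<Sum>i\<in>A. (a i)\<^sup>2" and ?b = "\<Sum>i\<in>A. (b i)\<^sup>2" and ?n = "2 ^ card A :: real"
  \<comment> \<open>The left side expands to 2(u^2 + r^2)(v^2 + s^2) + 8 u v r s. The square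
    \<open>(r * v - s * u)\<close> absorbs the mixed product and raises two coefficients from 2 to
    6, twice the constant 3 of the claim.\<close>
  have pointwise: "(u - r)\<^sup>2 * (v - s)\<^sup>2 + (u + r)\<^sup>2 * (v + s)\<^sup>2
      \<le> 2 * (u\<^sup>2 * v\<^sup>2) + 6 * r\<^sup>2 * v\<^sup>2 + 6 * s\<^sup>2 * u\<^sup>2 + 2 * (r\<^sup>2 * s\<^sup>2)" for u v r s :: real
  proof -
    have "0 \<le> 4 * (r * v - s * u)\<^sup>2" by simp
    then show ?thesis by (simp add: power2_eq_square algebra_simps)
  qed
  have "(\<Sum>S\<in>Pow (insert x A). (\<Sum>i\<in>insert x A. a i * subset_sign S i)\<^sup>2
          * (\<Sum>i\<in>insert x A. b i * subset_sign S i)\<^sup>2)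
      = (\<Sum>S\<in>Pow A. (?X S - a x)\<^sup>2 * (?Y S - b x)\<^sup>2 + (?X S + a x)\<^sup>2 * (?Y S + b x)\<^sup>2)"
    unfolding sum_Pow_insert[OF insert.hyps]
    by (intro sum.cong refl) (simp add: signed_sum_insert[OF insert.hyps] del: sum.insert)
  also have "\<dots> \<le> (\<Sum>S\<in>Pow A. 2 * ((?X S)\<^sup>2 * (?Y S)\<^sup>2) + 6 * (a x)\<^sup>2 * (?Y S)\<^sup>2
      + 6 * (b x)\<^sup>2 * (?X S)\<^sup>2 + 2 * ((a x)\<^sup>2 * (b x)\<^sup>2))"
    by (intro sum_mono pointwise)
  also have "\<dots> = 2 * (\<Sum>S\<in>Pow A. (?X S)\<^sup>2 * (?Y S)\<^sup>2) + 6 * (a x)\<^sup>2 * (?n * ?b)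
      + 6 * (b x)\<^sup>2 * (?n * ?a) + ?n * (2 * ((a x)\<^sup>2 * (b x)\<^sup>2))"
    unfolding sum.distrib sum_distrib_left[symmetric] signed_sum_second_moment[OF insert.hyps(1)]
    by (simp add: card_Pow insert.hyps)
  \<comment> \<open>Besides using the induction hypothesis, the last coefficient is loosened from 2
    to 6, so that the four terms factor as a product of the two enlarged sums of squares.\<close>
  also have "\<dots> \<le> 2 * (3 * ?n * (?a * ?b)) + 6 * (a x)\<^sup>2 * (?n * ?b)
      + 6 * (b x)\<^sup>2 * (?n * ?a) + ?n * (6 * ((a x)\<^sup>2 * (b x)\<^sup>2))"
    using insert.IH by (intro add_mono mult_left_mono) auto
  also have "\<dots> = 3 * 2 ^ card (insert x A) * ((\<Sum>i\<in>insert x A. (a i)\<^sup>2) * (\<Sum>i\<in>insert x A. (b i)\<^sup>2))"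
    using insert.hyps by (simp add: algebra_simps)
  finally show ?case .
qed simp

section \<open>Bilinear forms in two independent families of signs\<close>

definition bilinear_signed_sum ::
    "'a set \<Rightarrow> 'b set \<Rightarrow> ('a \<Rightarrow> 'b \<Rightarrow> real) \<Rightarrow> 'a set \<Rightarrow> 'b set \<Rightarrow> real" where
  "bilinear_signed_sum A B D S T
     = (\<Sum>i\<in>A. (\<Sum>j\<in>B. D i j * subset_sign T j) * subset_sign S i)"

text \<open>For fixed \<open>T\<close> the form is linear in the signs of \<open>S\<close>, with the
  signed row sums as coefficients. The linear identity is applied over \<open>S\<close>, then over
  \<open>T\<close> in each row.\<close>

lemma bilinear_second_moment:
  assumes "finite A" "finite B"
  shows "(\<Sum>(S, T)\<in>Pow A \<times> Pow B. (bilinear_signed_sum A B D S T)\<^sup>2)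
    = 2 ^ card A * 2 ^ card B * (\<Sum>i\<in>A. \<Sum>j\<in>B. (D i j)\<^sup>2)"
proof -
  have "(\<Sum>(S, T)\<in>Pow A \<times> Pow B. (bilinear_signed_sum A B D S T)\<^sup>2)
      = (\<Sum>T\<in>Pow B. \<Sum>S\<in>Pow A. (bilinear_signed_sum A B D S T)\<^sup>2)"
    by (subst sum.cartesian_product[symmetric]) (rule sum.swap)
  also have "\<dots> = 2 ^ card A * (\<Sum>i\<in>A. \<Sum>T\<in>Pow B. (\<Sum>j\<in>B. D i j * subset_sign T j)\<^sup>2)"
    unfolding bilinear_signed_sum_def signed_sum_second_moment[OF assms(1)]
      sum_distrib_left[symmetric] by (subst sum.swap) simp
  also have "\<dots> = 2 ^ card A * 2 ^ card B * (\<Sum>i\<in>A. \<Sum>j\<in>B. (D i j)\<^sup>2)"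
    unfolding signed_sum_second_moment[OF assms(2)] sum_distrib_left[symmetric] by simp
  finally show ?thesis .
qed

text \<open>Khinchin over \<open>S\<close> leaves the square of a sum of squared row sums. Expanding
  it gives products for two rows \<open>i\<close> and \<open>l\<close>, which the mixed inequality
  averages over \<open>T\<close>; each variable costs a factor 3.\<close>

lemma bilinear_fourth_moment:
  assumes "finite A" "finite B"
  shows "(\<Sum>(S, T)\<in>Pow A \<times> Pow B. (bilinear_signed_sum A B D S T) ^ 4)
    \<le> 9 * (2 ^ card A * 2 ^ card B) * (\<Sum>i\<in>A. \<Sum>j\<in>B. (D i j)\<^sup>2)\<^sup>2"
proof -
  let ?R = "\<lambda>i T. \<Sum>j\<in>B. D i j * subset_sign T j"
  have "(\<Sum>(S, T)\<in>Pow A \<times> Pow B. (bilinear_signed_sum A B D S T) ^ 4)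
      = (\<Sum>T\<in>Pow B. \<Sum>S\<in>Pow A. (bilinear_signed_sum A B D S T) ^ 4)"
    by (subst sum.cartesian_product[symmetric]) (rule sum.swap)
  also have "\<dots> \<le> (\<Sum>T\<in>Pow B. 3 * 2 ^ card A * ((\<Sum>i\<in>A. (?R i T)\<^sup>2) * (\<Sum>i\<in>A. (?R i T)\<^sup>2)))"
  proof (intro sum_mono)
    fix T
    show "(\<Sum>S\<in>Pow A. (bilinear_signed_sum A B D S T) ^ 4)
        \<le> 3 * 2 ^ card A * ((\<Sum>i\<in>A. (?R i T)\<^sup>2) * (\<Sum>i\<in>A. (?R i T)\<^sup>2))"
      using signed_sum_mixed_fourth_moment[OF assms(1), of "\<lambda>i. ?R i T" "\<lambda>i. ?R i T"]
      by (simp add: bilinear_signed_sum_def flip: power_add)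
  qed
  also have "\<dots> = 3 * 2 ^ card A * (\<Sum>i\<in>A. \<Sum>l\<in>A. \<Sum>T\<in>Pow B. (?R i T)\<^sup>2 * (?R l T)\<^sup>2)"
    unfolding sum_product by (simp add: sum_distrib_left sum.swap[of _ "Pow B" A])
  also have "\<dots> \<le> 3 * 2 ^ card A *
      (\<Sum>i\<in>A. \<Sum>l\<in>A. 3 * 2 ^ card B * ((\<Sum>j\<in>B. (D i j)\<^sup>2) * (\<Sum>j\<in>B. (D l j)\<^sup>2)))"
    by (intro mult_left_mono sum_mono signed_sum_mixed_fourth_moment assms) auto
  also have "\<dots> = 9 * (2 ^ card A * 2 ^ card B) * (\<Sum>i\<in>A. \<Sum>j\<in>B. (D i j)\<^sup>2)\<^sup>2"
    unfolding power2_eq_square[of "sum _ A"] sum_product[of _ A] sum_distrib_left[symmetric]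
    by simp
  finally show ?thesis .
qed

text \<open>An indicator is (1 + sign) / 2, and the constant part vanishes against coefficients of
  total zero. Doing this in each variable gives the factor 1/4.\<close>

lemma sum_rectangle_eq_bilinear_signed_sum:
  assumes "finite A" "finite B" "S \<subseteq> A" "T \<subseteq> B"
    and rows: "\<And>i. i \<in> A \<Longrightarrow> (\<Sum>j\<in>B. D i j) = 0"
    and cols: "\<And>j. j \<in> B \<Longrightarrow> (\<Sum>i\<in>A. D i j) = 0"
  shows "(\<Sum>i\<in>S. \<Sum>j\<in>T. D i j) = bilinear_signed_sum A B D S T / 4"
proof -
  have indicator: "(\<Sum>j\<in>U. f j) = (\<Sum>j\<in>C. f j * ((1 + subset_sign U j) / 2))"
    if "finite C" "U \<subseteq> C" for U C and f :: "'c \<Rightarrow> real"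
    using that by (intro sum.mono_neutral_cong_left) (auto simp: subset_sign_def)
  have half: "(\<Sum>j\<in>U. f j) = (\<Sum>j\<in>C. f j * subset_sign U j) / 2"
    if "finite C" "U \<subseteq> C" "(\<Sum>j\<in>C. f j) = 0" for U C and f :: "'c \<Rightarrow> real"
    unfolding indicator[OF that(1,2)] using that(3)
    by (simp add: sum.distrib sum_divide_distrib[symmetric] distrib_left add_divide_distrib)
  have "(\<Sum>i\<in>S. \<Sum>j\<in>T. D i j) = (\<Sum>i\<in>S. (\<Sum>j\<in>B. D i j * subset_sign T j) / 2)"
    using assms by (intro sum.cong refl half) auto
  also have "\<dots> = (\<Sum>i\<in>A. (\<Sum>j\<in>B. D i j * subset_sign T j) / 2 * subset_sign S i) / 2"
  proof (rule half[OF assms(1,3)])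
    \<comment> \<open>Halving over \<open>A\<close> needs the signed row sums to have total zero;
      exchanging the sums reduces this to the zero column sums.\<close>
    have "(\<Sum>i\<in>A. \<Sum>j\<in>B. D i j * subset_sign T j) = (\<Sum>j\<in>B. (\<Sum>i\<in>A. D i j) * subset_sign T j)"
      by (subst sum.swap) (simp add: sum_distrib_right)
    also have "\<dots> = 0" by (simp add: cols)
    finally show "(\<Sum>i\<in>A. (\<Sum>j\<in>B. D i j * subset_sign T j) / 2) = 0"
      by (simp flip: sum_divide_distrib)
  qed
  also have "\<dots> = bilinear_signed_sum A B D S T / 4"
    by (simp add: bilinear_signed_sum_def flip: sum_divide_distrib)
  finally show ?thesis .
qed

section \<open>Second-moment lower bound under counting measure\<close>

text \<open>Points with \<open>W x \<le> m / 2\<close> supply at most half of the total, so the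
  others supply at least half. Cauchy-Schwarz against their indicator bounds their number from
  below; the 4 comes from squaring 1/2.\<close>

lemma Paley_Zygmund_sum:
  fixes W :: "'a \<Rightarrow> real" and C m :: real
  assumes "finite \<Omega>"
    and mean: "(\<Sum>x\<in>\<Omega>. W x) = card \<Omega> * m"
    and square: "(\<Sum>x\<in>\<Omega>. (W x)\<^sup>2) \<le> C * card \<Omega> * m\<^sup>2"
    and "m > 0"
  shows "real (card \<Omega>) \<le> 4 * C * card {x\<in>\<Omega>. W x > m / 2}"
proof (cases "\<Omega> = {}")
  case False
  let ?G = "{x\<in>\<Omega>. W x > m / 2}"
  let ?n = "real (card \<Omega>)"
  have n: "?n > 0" using False assms(1) by (simp add: card_gt_0_iff)
  have "?n * m = (\<Sum>x\<in>\<Omega>. W x)" by (simp add: mean)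
  also have "\<dots> \<le> (\<Sum>x\<in>\<Omega>. m / 2 + W x * indicator ?G x)"
    using \<open>m > 0\<close> by (intro sum_mono) (auto simp: indicator_def)
  also have "\<dots> = ?n * m / 2 + (\<Sum>x\<in>\<Omega>. W x * indicator ?G x)"
    by (simp add: sum.distrib)
  finally have "?n * m / 2 \<le> (\<Sum>x\<in>\<Omega>. W x * indicator ?G x)" by simp
  then have "(?n * m / 2)\<^sup>2 \<le> (\<Sum>x\<in>\<Omega>. W x * indicator ?G x)\<^sup>2"
    using \<open>m > 0\<close> by (intro power_mono) auto
  also have "\<dots> \<le> (\<Sum>x\<in>\<Omega>. (W x)\<^sup>2) * (\<Sum>x\<in>\<Omega>. (indicator ?G x)\<^sup>2)"
    by (rule Cauchy_Schwarz_ineq_sum)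
  also have "(\<Sum>x\<in>\<Omega>. (indicator ?G x :: real)\<^sup>2) = (\<Sum>x\<in>?G. 1)"
    using assms(1) by (intro sum.mono_neutral_cong_right) auto
  also have "(\<Sum>x\<in>\<Omega>. (W x)\<^sup>2) * (\<Sum>x\<in>?G. 1) \<le> C * ?n * m\<^sup>2 * card ?G"
    using square by (simp add: mult_right_mono)
  finally have "(?n * m\<^sup>2) * ?n \<le> (?n * m\<^sup>2) * (4 * C * card ?G)"
    by (simp add: power2_eq_square algebra_simps)
  then show ?thesis using n \<open>m > 0\<close> by (simp add: mult_le_cancel_left_pos)
qed simp

section \<open>Marginals, uniform subset pairs and total variation as finite sums\<close>

lemma sum_pmf_row:
  assumes "set_pmf p \<subseteq> A \<times> B" "finite B"
  shows "(\<Sum>j\<in>B. pmf p (i, j)) = pmf (map_pmf fst p) i"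
proof -
  have "(\<Sum>j\<in>B. pmf p (i, j)) = (\<Sum>x\<in>{i} \<times> B. pmf p x)"
    by (simp add: sum.cartesian_product')
  also have "\<dots> = measure_pmf.prob p ({i} \<times> B)"
    using assms by (simp add: measure_measure_pmf_finite)
  also have "\<dots> = measure_pmf.prob p (fst -` {i})"
    using assms by (intro measure_pmf.finite_measure_eq_AE) (auto simp: AE_measure_pmf_iff)
  finally show ?thesis by (simp add: pmf_map)
qed

lemma sum_pmf_column:
  assumes "set_pmf p \<subseteq> A \<times> B" "finite A"
  shows "(\<Sum>i\<in>A. pmf p (i, j)) = pmf (map_pmf snd p) j"
proof -
  have "(\<Sum>i\<in>A. pmf p (i, j)) = (\<Sum>x\<in>A \<times> {j}. pmf p x)"
    by (simp add: sum.cartesian_product')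
  also have "\<dots> = measure_pmf.prob p (A \<times> {j})"
    using assms by (simp add: measure_measure_pmf_finite)
  also have "\<dots> = measure_pmf.prob p (snd -` {j})"
    using assms by (intro measure_pmf.finite_measure_eq_AE) (auto simp: AE_measure_pmf_iff)
  finally show ?thesis by (simp add: pmf_map)
qed

text \<open>A product of uniform distributions is uniform on the product set, so probabilities
  reduce to counting.\<close>

lemma prob_random_subset_pair:
  "measure_pmf.prob (random_subset_pair k) E
     = card {x \<in> Pow {1..k} \<times> Pow {1..k}. x \<in> E} / (2 ^ k * 2 ^ k)"
proof -
  have "random_subset_pair k = pmf_of_set (Pow {1..k} \<times> Pow {1..k})"
    unfolding random_subset_pair_def
  proof (rule pmf_eqI)
    fix x :: "nat set \<times> nat set"
    have "Pow {1..k} \<times> Pow {1..k} \<noteq> {}" by blast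
    then show "pmf (pair_pmf (pmf_of_set (Pow {1..k})) (pmf_of_set (Pow {1..k}))) x
        = pmf (pmf_of_set (Pow {1..k} \<times> Pow {1..k})) x"
      by (cases x) (simp add: pmf_pair indicator_times card_cartesian_product Pow_not_empty)
  qed
  moreover have "Pow {1..k} \<times> Pow {1..k} \<noteq> {}" by blast
  ultimately show ?thesis
    by (simp add: measure_pmf_of_set card_cartesian_product card_Pow Int_def)
qed

lemma d_TV_eq_sum:
  assumes "finite A" "set_pmf p \<subseteq> A" "set_pmf q \<subseteq> A"
  shows "d_TV p q = (\<Sum>x\<in>A. \<bar>pmf p x - pmf q x\<bar>) / 2"
proof -
  have "(\<Sum>\<^sub>\<infinity>x\<in>UNIV. \<bar>pmf p x - pmf q x\<bar>) = (\<Sum>\<^sub>\<infinity>x\<in>A. \<bar>pmf p x - pmf q x\<bar>)"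
    using assms by (intro infsum_cong_neutral) (auto simp: set_pmf_iff subset_iff, metis)
  then show ?thesis using assms(1) by (simp add: d_TV_def)
qed

theorem theorem6:
  fixes k :: nat and \<epsilon> :: real
    and p :: "(nat \<times> nat) pmf" and p1 p2 :: "nat pmf"
  assumes "k \<ge> 1" and "\<epsilon> > 0"
    and "set_pmf p \<subseteq> {1..k} \<times> {1..k}"
    and "p1 = map_pmf fst p" and "p2 = map_pmf snd p"
  shows "(p = pair_pmf p1 p2 \<longrightarrow>
           measure_pmf.prob (random_subset_pair k)
             {(S1, S2). measure_pmf.prob p (S1 \<times> S2)
                = measure_pmf.prob p1 S1 * measure_pmf.prob p2 S2} = 1)
       \<and> (d_TV p (pair_pmf p1 p2) > \<epsilon> \<longrightarrow>
           measure_pmf.prob (random_subset_pair k)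
             {(S1, S2). (measure_pmf.prob p (S1 \<times> S2)
                - measure_pmf.prob p1 S1 * measure_pmf.prob p2 S2)\<^sup>2
                > \<epsilon>\<^sup>2 / (8 * (real k)\<^sup>2)} \<ge> 1 / 4096)"
proof (intro conjI impI)
  assume "p = pair_pmf p1 p2"
  \<comment> \<open>The identity holds for every pair of sets, so the event is the whole
    space.\<close>
  then have "measure_pmf.prob p (S1 \<times> S2) = measure_pmf.prob p1 S1 * measure_pmf.prob p2 S2"
    for S1 S2 by (metis measure_pmf_prob_product countableI_type)
  then show "measure_pmf.prob (random_subset_pair k)
      {(S1, S2). measure_pmf.prob p (S1 \<times> S2)
        = measure_pmf.prob p1 S1 * measure_pmf.prob p2 S2} = 1"
    by simp
next
  assume far: "d_TV p (pair_pmf p1 p2) > \<epsilon>"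
  let ?I = "{1..k}" and ?\<Omega> = "Pow {1..k} \<times> Pow {1..k}"
  define D where "D i j = pmf p (i, j) - pmf p1 i * pmf p2 j" for i j
  define Z where "Z = bilinear_signed_sum ?I ?I D"
  define m where "m = (\<Sum>i\<in>?I. \<Sum>j\<in>?I. (D i j)\<^sup>2)"
  note supp = \<open>set_pmf p \<subseteq> ?I \<times> ?I\<close>
  have supp1: "set_pmf p1 \<subseteq> ?I" and supp2: "set_pmf p2 \<subseteq> ?I"
    using supp by (auto simp: \<open>p1 = _\<close> \<open>p2 = _\<close>)
  have row: "(\<Sum>j\<in>?I. D i j) = 0" for i
    using sum_pmf_row[OF supp, of i] sum_pmf_eq_1[OF _ supp2]
    by (simp add: D_def sum_subtractf \<open>p1 = _\<close> flip: sum_distrib_left)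
  have col: "(\<Sum>i\<in>?I. D i j) = 0" for j
    using sum_pmf_column[OF supp, of j] sum_pmf_eq_1[OF _ supp1]
    by (simp add: D_def sum_subtractf \<open>p2 = _\<close> flip: sum_distrib_right)

  have disc: "measure_pmf.prob p (S \<times> T) - measure_pmf.prob p1 S * measure_pmf.prob p2 T = Z S T / 4"
    if "S \<subseteq> ?I" "T \<subseteq> ?I" for S T
  proof -
    have fin: "finite S" "finite T" using that finite_subset by blast+
    then have "measure_pmf.prob p (S \<times> T) - measure_pmf.prob p1 S * measure_pmf.prob p2 T
        = (\<Sum>i\<in>S. \<Sum>j\<in>T. D i j)"
      by (simp add: measure_measure_pmf_finite D_def sum_subtractf sum_product
          sum.cartesian_product case_prod_unfold)
    then show ?thesis
      unfolding Z_def using sum_rectangle_eq_bilinear_signed_sum[OF _ _ that row col] by simp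
  qed

  \<comment> \<open>The 2 undoes the factor 1/2 in \<open>d_TV\<close>. Cauchy-Schwarz against the
    constant 1 on the \<open>k^2\<close> cells then turns this L1 bound into a lower bound on
    \<open>m\<close>, the mean of \<open>Z^2\<close>.\<close>
  have "2 * \<epsilon> < (\<Sum>x\<in>?I \<times> ?I. \<bar>pmf p x - pmf (pair_pmf p1 p2) x\<bar>)"
  proof -
    have "set_pmf (pair_pmf p1 p2) \<subseteq> ?I \<times> ?I"
      using supp1 supp2 by auto
    then show ?thesis using far d_TV_eq_sum[OF _ supp] by simp
  qed
  also have "\<dots> = (\<Sum>(i, j)\<in>?I \<times> ?I. \<bar>D i j\<bar> * 1)"
    by (intro sum.cong) (auto simp: D_def pmf_pair)
  finally have "(2 * \<epsilon>)\<^sup>2 < (\<Sum>(i, j)\<in>?I \<times> ?I. \<bar>D i j\<bar> * 1)\<^sup>2"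
    using \<open>\<epsilon> > 0\<close> by (intro power_strict_mono) auto
  also have "\<dots> \<le> (\<Sum>(i, j)\<in>?I \<times> ?I. (D i j)\<^sup>2) * (real k)\<^sup>2"
    using Cauchy_Schwarz_ineq_sum[of "\<lambda>(i, j). \<bar>D i j\<bar>" "\<lambda>_. 1" "?I \<times> ?I"]
    by (simp add: case_prod_unfold power2_eq_square)
  also have "(\<Sum>(i, j)\<in>?I \<times> ?I. (D i j)\<^sup>2) = m"
    by (simp add: m_def sum.cartesian_product)
  finally have m: "4 * \<epsilon>\<^sup>2 / (real k)\<^sup>2 < m"
    using \<open>k \<ge> 1\<close> by (simp add: field_simps power2_eq_square)
  have "0 \<le> 4 * \<epsilon>\<^sup>2 / (real k)\<^sup>2" by simp
  with m have "m > 0" by linarith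

  let ?G = "{x\<in>?\<Omega>. (case x of (S, T) \<Rightarrow> (Z S T)\<^sup>2) > m / 2}"
  have "real (card ?\<Omega>) \<le> 4 * 9 * real (card ?G)"
  proof (rule Paley_Zygmund_sum)
    show "(\<Sum>x\<in>?\<Omega>. case x of (S, T) \<Rightarrow> (Z S T)\<^sup>2) = card ?\<Omega> * m"
      by (simp add: Z_def m_def bilinear_second_moment card_cartesian_product card_Pow)
    show "(\<Sum>x\<in>?\<Omega>. (case x of (S, T) \<Rightarrow> (Z S T)\<^sup>2)\<^sup>2) \<le> 9 * real (card ?\<Omega>) * m\<^sup>2"
      using bilinear_fourth_moment[of ?I ?I D]
      by (simp add: Z_def m_def case_prod_unfold card_cartesian_product card_Pow)
  qed (use \<open>m > 0\<close> in auto)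
  then have card: "2 ^ k * 2 ^ k \<le> 36 * real (card ?G)"
    by (simp add: card_cartesian_product card_Pow)

  let ?E = "{(S1, S2). (measure_pmf.prob p (S1 \<times> S2)
      - measure_pmf.prob p1 S1 * measure_pmf.prob p2 S2)\<^sup>2 > \<epsilon>\<^sup>2 / (8 * (real k)\<^sup>2)}"
  have "?G \<subseteq> {x\<in>?\<Omega>. x \<in> ?E}"
  proof
    fix x assume "x \<in> ?G"
    then obtain S T where x: "x = (S, T)" "S \<subseteq> ?I" "T \<subseteq> ?I" and "m / 2 < (Z S T)\<^sup>2"
      by auto
    \<comment> \<open>The constants combine as Z^2 / 16 > m / 32 > 4 \<epsilon>^2 / (32
      k^2).\<close>
    then have "\<epsilon>\<^sup>2 / (8 * (real k)\<^sup>2) < (Z S T / 4)\<^sup>2"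
      using m by (simp add: power_divide)
    then have "(S, T) \<in> ?E"
      by (simp only: mem_Collect_eq prod.case disc[OF x(2,3)])
    then show "x \<in> {x\<in>?\<Omega>. x \<in> ?E}"
      using x by blast
  qed
  then have "card ?G \<le> card {x\<in>?\<Omega>. x \<in> ?E}"
    by (intro card_mono) auto
  \<comment> \<open>The count gives 1/36, which is weakened here to the stated constant.\<close>
  with card have "2 ^ k * 2 ^ k \<le> 4096 * real (card {x\<in>?\<Omega>. x \<in> ?E})"
    by linarith
  then show "1 / 4096 \<le> measure_pmf.prob (random_subset_pair k) ?E"
    unfolding prob_random_subset_pair by (simp add: field_simps)
qed

end
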